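(* For every $0<\alpha<1$ there is a constant $C_\alpha$ depending only on $\alpha$ such that for every $n\ge1$ and every $A\subset\{-1,1\}^n$, $$\sum_{S\ne\varnothing}|S|^\alpha\,\widehat{\mathbf 1_A}(S)^2\ \le\ C_\alpha\,\mathbb E\,\omega_\alpha(h_A(x)).$$ In particular, for $\alpha=1/2$, there is a universal constant $C$ such that for every $n\geq 1$ and every $A\subset\{-1,1\}^n$, $$\sum_{S\ne\varnothing}\sqrt{|S|}\,\widehat{\mathbf 1_A}(S)^2\ \le\ C\,\mathbb E\big[\sqrt{h_A(x)}\,\log(e+h_A(x))\big].$$
   Context: $\{-1,1\}^n$ carries the uniform probability measure, with expectation $\mathbb E$. For $S\subseteq[n]=\{1,\dots,n\}$, $\chi_S(x)=\prod_{i\in S}x_i$ and $\widehat g(S)=\mathbb E[g\chi_S]$. $x^{\oplus i}$ is $x$ with the $i$th coordinate flipped. $\mathbf 1_A$ is the indicator of $A$, and $h_A(x)=\#\{i\in[n]: x\in A,\ x^{\oplus i}\notin A\}$ (so $h_A(x)=0$ for $x\notin A$). The function $\omega_\alpha$ on nonnegative integers is defined by $\omega_\alpha(0)=0$ and, for $m\ge1$: $\omega_\alpha(m)=\sqrt m$ if $0<\alpha<1/2$; $\omega_{1/2}(m)=\sqrt m\log(e+m)$; $\omega_\alpha(m)=m^\alpha$ if $1/2<\alpha<1$. *)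

theory Defs
  imports "HOL-Probability.Probability"
begin

text \<open>
  The dimension \<open>n\<close> is quantified after the constants in the theorem, so points of
  \<open>{-1,1}\<^sup>n\<close> are extensional functions on the index set \<open>{1..n}\<close>
  (equal to \<^term>\<open>undefined\<close> elsewhere), not vectors over a finite type.
\<close>

definition cube :: "nat \<Rightarrow> (nat \<Rightarrow> real) set" where
  "cube n = {1..n} \<rightarrow>\<^sub>E {-1, 1}"

definition cube_expectation :: "nat \<Rightarrow> ((nat \<Rightarrow> real) \<Rightarrow> real) \<Rightarrow> real" where
  "cube_expectation n f = measure_pmf.expectation (pmf_of_set (cube n)) f"

definition character :: "nat set \<Rightarrow> (nat \<Rightarrow> real) \<Rightarrow> real" where
  "character S x = (\<Prod>i\<in>S. x i)"

definition fourier_coeff :: "nat \<Rightarrow> ((nat \<Rightarrow> real) \<Rightarrow> real) \<Rightarrow> nat set \<Rightarrow> real" where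
  "fourier_coeff n g S = cube_expectation n (\<lambda>x. g x * character S x)"

definition flip :: "nat \<Rightarrow> (nat \<Rightarrow> real) \<Rightarrow> (nat \<Rightarrow> real)" where
  "flip i x = x(i := - x i)"

definition boundary_count :: "nat \<Rightarrow> (nat \<Rightarrow> real) set \<Rightarrow> (nat \<Rightarrow> real) \<Rightarrow> nat" where
  "boundary_count n A x = card {i \<in> {1..n}. x \<in> A \<and> flip i x \<notin> A}"

text \<open>Only used for \<open>0 < \<alpha> < 1\<close>; the logarithm is natural.\<close>

definition omega :: "real \<Rightarrow> nat \<Rightarrow> real" where
  "omega \<alpha> m =
    (if m = 0 then 0
     else if \<alpha> < 1/2 then sqrt (real m)
     else if \<alpha> = 1/2 then sqrt (real m) * ln (exp 1 + real m)
     else real m powr \<alpha>)"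

lemma finite_cube: "finite (cube n)"
  by (simp add: cube_def finite_PiE)

lemma card_cube: "card (cube n) = 2 ^ n"
  by (simp add: cube_def card_PiE numeral_2_eq_2)

lemma cube_nonempty: "cube n \<noteq> {}"
  using card_cube[of n] by auto

lemma flip_in_cube: "x \<in> cube n \<Longrightarrow> i \<in> {1..n} \<Longrightarrow> flip i x \<in> cube n"
  unfolding cube_def flip_def by (auto simp: PiE_iff extensional_def)

lemma cube_expectation_eq: "cube_expectation n f = (\<Sum>x\<in>cube n. f x) / 2 ^ n"
  by (simp add: cube_expectation_def integral_pmf_of_set[OF cube_nonempty finite_cube] card_cube)

end

theory Submission
  imports Defs
begin

text \<open>
  Fix \<open>A\<close> and write \<open>c S\<close> for the Fourier coefficients of its indicator \<open>f\<close>. The inequality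
  is Talagrand's one-sided isoperimetric inequality, applied at every noise scale and then
  integrated against the scale.

  Talagrand's inequality bounds the variance of \<open>f\<close> by the expectation of the square root of the
  boundary count. It follows from a Bobkov-type inequality for \<open>[0,1]\<close>-valued functions with
  the profile \<open>t (1 - t)\<close>: this profile satisfies an elementary two-point inequality
  (\<open>two_point_inequality\<close>), which tensorises by Minkowski's inequality. The induction runs over
  averaging operators \<open>subcube_average J\<close> on a fixed cube, so that it gives at once the version in
  which only the coordinates in a set \<open>J\<close> are averaged (\<open>bobkov_type_inequality\<close>,
  \<open>talagrand_on_subcubes\<close>). Averaging over \<open>J\<close> kills exactly the characters \<open>S\<close> that meet \<open>J\<close>, so by
  Parseval the sum of \<open>(c S)\<^sup>2\<close> over the sets \<open>S\<close> meeting \<open>J\<close> is at most the expectation of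
  the square root of the number of boundary edges in directions from \<open>J\<close>.

  Now let \<open>J\<close> be random, each coordinate being chosen independently with probability \<open>p\<close>. A set \<open>S\<close>
  meets \<open>J\<close> with probability \<open>1 - (1 - p) ^ card S\<close>, and of the \<open>h\<close> boundary directions at a point
  a binomial number survives, whose square root has mean at most \<open>min (sqrt (p h)) (p h)\<close>.
  The outcome is \<open>noise_sensitivity_le\<close>.

  Finally take \<open>p = 2 powr (- k)\<close>, weight by \<open>2 powr (\<alpha> k)\<close> and sum over \<open>k\<close>. On the Fourier side the
  scale \<open>p\<close> of order \<open>1 / card S\<close> alone contributes a multiple of \<open>card S powr \<alpha>\<close>
  (\<open>powr_le_dyadic_sum\<close>). On the boundary side the scales \<open>p < 1 / h\<close> form a convergent geometric
  series of size \<open>h powr \<alpha>\<close>, while those with \<open>p \<ge> 1 / h\<close> give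
  \<open>sqrt h\<close> times a geometric sum with ratio \<open>2 powr (\<alpha> - 1/2)\<close>; whether this ratio is below, equal to or
  above 1 produces the three regimes of \<open>omega \<alpha>\<close>, and ratio 1 is the source of the logarithm.
\<close>

section \<open>Averaging over subcubes\<close>

definition flip_all :: "nat set \<Rightarrow> (nat \<Rightarrow> real) \<Rightarrow> (nat \<Rightarrow> real)" where
  "flip_all T x = (\<lambda>i. if i \<in> T then - x i else x i)"

definition subcube_average :: "nat set \<Rightarrow> ((nat \<Rightarrow> real) \<Rightarrow> real) \<Rightarrow> (nat \<Rightarrow> real) \<Rightarrow> real" where
  "subcube_average J f x = (\<Sum>T\<in>Pow J. f (flip_all T x)) / 2 ^ card J"

lemma subcube_average_empty [simp]: "subcube_average {} f = f"
  by (simp add: subcube_average_def flip_all_def fun_eq_iff)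

lemma subcube_average_insert:
  assumes "finite J" "i \<notin> J"
  shows "subcube_average (insert i J) f x
       = (subcube_average J f x + subcube_average J f (flip i x)) / 2"
proof -
  have inj: "inj_on (insert i) (Pow J)"
    using assms(2) by (auto simp: inj_on_def)
  have "(\<Sum>T\<in>Pow (insert i J). f (flip_all T x))
      = (\<Sum>T\<in>Pow J. f (flip_all T x)) + (\<Sum>T\<in>insert i ` Pow J. f (flip_all T x))"
    unfolding Pow_insert using assms by (intro sum.union_disjoint) auto
  also have "(\<Sum>T\<in>insert i ` Pow J. f (flip_all T x)) = (\<Sum>T\<in>Pow J. f (flip_all (insert i T) x))"
    by (simp add: sum.reindex[OF inj])
  also have "\<dots> = (\<Sum>T\<in>Pow J. f (flip_all T (flip i x)))"
  proof (rule sum.cong[OF refl])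
    fix T assume "T \<in> Pow J"
    then have "flip_all (insert i T) x = flip_all T (flip i x)"
      using assms(2) by (auto simp: flip_all_def flip_def fun_eq_iff)
    then show "f (flip_all (insert i T) x) = f (flip_all T (flip i x))" by simp
  qed
  finally show ?thesis
    using assms by (simp add: subcube_average_def add_divide_distrib)
qed

lemma flip_all_flip: "flip_all T (flip i x) = flip i (flip_all T x)"
  by (auto simp: flip_all_def flip_def fun_eq_iff)

lemma subcube_average_comp_flip:
  "subcube_average J f (flip i x) = subcube_average J (\<lambda>y. f (flip i y)) x"
  by (simp add: subcube_average_def flip_all_flip)

lemma subcube_average_mono:
  "(\<And>y. f y \<le> g y) \<Longrightarrow> subcube_average J f x \<le> subcube_average J g x"
  by (simp add: subcube_average_def divide_right_mono sum_mono)

lemma subcube_average_diff: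
  "subcube_average J (\<lambda>y. f y - g y) x = subcube_average J f x - subcube_average J g x"
  by (simp add: subcube_average_def sum_subtractf diff_divide_distrib)

lemma subcube_average_cmult:
  "subcube_average J (\<lambda>y. c * f y) x = c * subcube_average J f x"
  by (simp add: subcube_average_def sum_distrib_left)

lemma subcube_average_const: "finite J \<Longrightarrow> subcube_average J (\<lambda>y. c) x = c"
  by (simp add: subcube_average_def card_Pow)

text \<open>
  This is Minkowski's inequality for averages of vectors in the Euclidean plane. Regarding the pair
  \<open>(f, g)\<close> as a complex-valued function turns it into the triangle inequality for the modulus.
\<close>

lemma sqrt_sum_squares_average_le:
  "sqrt ((subcube_average J f x)\<^sup>2 + (subcube_average J g x)\<^sup>2)
     \<le> subcube_average J (\<lambda>y. sqrt ((f y)\<^sup>2 + (g y)\<^sup>2)) x"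
proof -
  define z where "z y = Complex (f y) (g y)" for y
  have "sqrt ((\<Sum>T\<in>Pow J. f (flip_all T x))\<^sup>2 + (\<Sum>T\<in>Pow J. g (flip_all T x))\<^sup>2)
      = cmod (\<Sum>T\<in>Pow J. z (flip_all T x))"
    by (simp add: cmod_def z_def)
  also have "\<dots> \<le> (\<Sum>T\<in>Pow J. cmod (z (flip_all T x)))"
    by (rule norm_sum)
  also have "\<dots> = (\<Sum>T\<in>Pow J. sqrt ((f (flip_all T x))\<^sup>2 + (g (flip_all T x))\<^sup>2))"
    by (simp add: cmod_def z_def)
  finally have *: "sqrt ((\<Sum>T\<in>Pow J. f (flip_all T x))\<^sup>2 + (\<Sum>T\<in>Pow J. g (flip_all T x))\<^sup>2) / 2 ^ card J
     \<le> subcube_average J (\<lambda>y. sqrt ((f y)\<^sup>2 + (g y)\<^sup>2)) x"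
    by (simp add: subcube_average_def divide_right_mono)
  have "sqrt ((subcube_average J f x)\<^sup>2 + (subcube_average J g x)\<^sup>2)
     = sqrt ((\<Sum>T\<in>Pow J. f (flip_all T x))\<^sup>2 + (\<Sum>T\<in>Pow J. g (flip_all T x))\<^sup>2) / 2 ^ card J"
    by (simp add: subcube_average_def power_divide add_divide_distrib[symmetric] real_sqrt_divide)
  with * show ?thesis by simp
qed

section \<open>Talagrand's inequality on subcubes\<close>

text \<open>
  With \<open>d = a - b\<close>, the profile \<open>t (1 - t)\<close> at the midpoint exceeds the mean of its values at the end
  points by exactly \<open>d\<^sup>2 / 4\<close>. So the square root has to exceed \<open>u = a (1 - a)\<close> by \<open>d\<^sup>2 / 2\<close>, and
  the constant \<open>1/2\<close> in front of \<open>d\<^sup>2\<close> suffices because \<open>u + d\<^sup>2 / 4 \<le> 1/2\<close>.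
  Only the larger of the two values carries a gradient term; this is what makes the final
  inequality one-sided.
\<close>

lemma two_point_inequality_ordered:
  fixes a b :: real
  assumes "0 \<le> b" "b \<le> a" "a \<le> 1"
  shows "(a + b) / 2 * (1 - (a + b) / 2)
       \<le> (sqrt ((a * (1 - a))\<^sup>2 + 1/2 * (a - b)\<^sup>2) + b * (1 - b)) / 2"
proof -
  define u where "u = a * (1 - a)"
  define d where "d = a - b"
  have "0 \<le> a * (1 - a)" using assms by (intro mult_nonneg_nonneg) auto
  moreover have "u = 1/4 - (a - 1/2)\<^sup>2"
    by (simp add: u_def power2_eq_square algebra_simps)
  ultimately have u: "0 \<le> u" "u \<le> 1/4"
    by (simp_all add: u_def)
  have d: "0 \<le> d" "d \<le> 1" using assms by (auto simp: d_def)
  have d2: "d\<^sup>2 \<le> 1" using d by (simp add: power_le_one)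
  have "(u + d\<^sup>2 / 2)\<^sup>2 = u\<^sup>2 + d\<^sup>2 * (u + d\<^sup>2 / 4)"
    by (simp add: power2_eq_square algebra_simps)
  also have "\<dots> \<le> u\<^sup>2 + d\<^sup>2 * (1/2)"
    using u d2 by (intro add_left_mono mult_left_mono) auto
  finally have "u + d\<^sup>2 / 2 \<le> sqrt (u\<^sup>2 + 1/2 * d\<^sup>2)"
    by (intro real_le_rsqrt) simp
  moreover have "(a + b) / 2 * (1 - (a + b) / 2) = (u + d\<^sup>2 / 2 + b * (1 - b)) / 2"
    by (simp add: u_def d_def power2_eq_square field_simps)
  ultimately show ?thesis by (simp add: u_def d_def)
qed

lemma two_point_inequality:
  fixes a b :: real
  assumes "0 \<le> a" "a \<le> 1" "0 \<le> b" "b \<le> 1"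
  shows "(a + b) / 2 * (1 - (a + b) / 2)
       \<le> (sqrt ((a * (1 - a))\<^sup>2 + 1/2 * (max 0 (a - b))\<^sup>2)
         + sqrt ((b * (1 - b))\<^sup>2 + 1/2 * (max 0 (b - a))\<^sup>2)) / 2"
proof (cases "b \<le> a")
  case True
  then show ?thesis
    using two_point_inequality_ordered[of b a] assms by (simp add: max_def)
next
  case False
  then show ?thesis
    using two_point_inequality_ordered[of a b] assms by (simp add: max_def add.commute)
qed

definition descent_sq :: "nat set \<Rightarrow> ((nat \<Rightarrow> real) \<Rightarrow> real) \<Rightarrow> (nat \<Rightarrow> real) \<Rightarrow> real" where
  "descent_sq J f x = (\<Sum>i\<in>J. (max 0 (f x - f (flip i x)))\<^sup>2)"

text \<open>
  When a coordinate \<open>i\<close> is added to \<open>J\<close>, the two-point inequality is applied to the values of the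
  \<open>J\<close>-average at \<open>x\<close> and at \<open>flip i x\<close>. The induction hypothesis controls the profile of each value,
  convexity of the positive part controls their difference, and Minkowski's inequality pulls the
  average out of the square root.
\<close>

lemma bobkov_type_inequality:
  assumes "finite J" and f: "\<And>y. 0 \<le> f y" "\<And>y. f y \<le> 1"
  shows "subcube_average J f x * (1 - subcube_average J f x)
       \<le> subcube_average J (\<lambda>y. sqrt ((f y * (1 - f y))\<^sup>2 + 1/2 * descent_sq J f y)) x"
  using assms(1)
proof (induction J arbitrary: x rule: finite_induct)
  case empty
  show ?case using f by (simp add: descent_sq_def)
next
  case (insert i J)
  let ?M = "subcube_average J"
  let ?U = "\<lambda>y. sqrt ((f y * (1 - f y))\<^sup>2 + 1/2 * descent_sq J f y)"
  let ?D = "\<lambda>y. max 0 (f y - f (flip i y))"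
  let ?V = "\<lambda>y. sqrt ((f y * (1 - f y))\<^sup>2 + 1/2 * descent_sq (insert i J) f y)"
  have M01: "0 \<le> ?M f y" "?M f y \<le> 1" for y
    using subcube_average_mono[of "\<lambda>_. 0" f J y] subcube_average_mono[of f "\<lambda>_. 1" J y] f insert.hyps
    by (simp_all add: subcube_average_const)
  have step: "sqrt ((?M f y * (1 - ?M f y))\<^sup>2 + 1/2 * (max 0 (?M f y - ?M f (flip i y)))\<^sup>2) \<le> ?M ?V y" for y
  proof -
    have "?M f y - ?M f (flip i y) = ?M (\<lambda>y. f y - f (flip i y)) y"
      by (simp add: subcube_average_comp_flip subcube_average_diff)
    also have "\<dots> \<le> ?M ?D y" by (rule subcube_average_mono) simp
    finally have "max 0 (?M f y - ?M f (flip i y)) \<le> ?M ?D y"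
      using subcube_average_mono[of "\<lambda>_. 0" ?D J y] insert.hyps
      by (simp add: subcube_average_const)
    then have 1: "1/2 * (max 0 (?M f y - ?M f (flip i y)))\<^sup>2 \<le> (?M (\<lambda>y. sqrt (1/2) * ?D y) y)\<^sup>2"
      unfolding subcube_average_cmult by (simp add: power_mult_distrib power_mono)
    have 2: "(?M f y * (1 - ?M f y))\<^sup>2 \<le> (?M ?U y)\<^sup>2"
      using insert.IH[of y] M01[of y] by (intro power_mono) auto
    have "sqrt ((?M f y * (1 - ?M f y))\<^sup>2 + 1/2 * (max 0 (?M f y - ?M f (flip i y)))\<^sup>2)
        \<le> sqrt ((?M ?U y)\<^sup>2 + (?M (\<lambda>y. sqrt (1/2) * ?D y) y)\<^sup>2)"
      using 1 2 by (intro real_sqrt_le_mono add_mono)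
    also have "\<dots> \<le> ?M (\<lambda>y. sqrt ((?U y)\<^sup>2 + (sqrt (1/2) * ?D y)\<^sup>2)) y"
      by (rule sqrt_sum_squares_average_le)
    also have "(\<lambda>y. sqrt ((?U y)\<^sup>2 + (sqrt (1/2) * ?D y)\<^sup>2)) = ?V"
    proof
      fix y
      have "0 \<le> descent_sq J f y" by (simp add: descent_sq_def sum_nonneg)
      then have "(?U y)\<^sup>2 = (f y * (1 - f y))\<^sup>2 + 1/2 * descent_sq J f y" by simp
      moreover have "(sqrt (1/2) * ?D y)\<^sup>2 = 1/2 * (?D y)\<^sup>2"
        by (simp add: power_mult_distrib)
      ultimately show "sqrt ((?U y)\<^sup>2 + (sqrt (1/2) * ?D y)\<^sup>2) = ?V y"
        using insert.hyps by (simp add: descent_sq_def algebra_simps)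
    qed
    finally show ?thesis .
  qed
  have ff: "flip i (flip i x) = x" by (simp add: flip_def fun_eq_iff)
  have "subcube_average (insert i J) f x * (1 - subcube_average (insert i J) f x)
      \<le> (?M ?V x + ?M ?V (flip i x)) / 2"
    unfolding subcube_average_insert[OF insert.hyps]
    using step[of x] step[of "flip i x"] unfolding ff
    by (intro order_trans[OF two_point_inequality[OF M01[of x] M01[of "flip i x"]]]
        divide_right_mono add_mono) auto
  then show ?case
    unfolding subcube_average_insert[OF insert.hyps] .
qed

text \<open>
  This generalises \<open>boundary_count n\<close>, the case \<open>J = {1..n}\<close>, to the boundary seen inside subcubes.
\<close>

definition boundary_count_in :: "nat set \<Rightarrow> (nat \<Rightarrow> real) set \<Rightarrow> (nat \<Rightarrow> real) \<Rightarrow> nat" where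
  "boundary_count_in J A x = card {i \<in> J. x \<in> A \<and> flip i x \<notin> A}"

lemma descent_sq_indicator:
  "finite J \<Longrightarrow> descent_sq J (indicat_real A) x = real (boundary_count_in J A x)"
proof -
  assume "finite J"
  have "descent_sq J (indicat_real A) x = (\<Sum>i\<in>J. if x \<in> A \<and> flip i x \<notin> A then 1 else 0)"
    unfolding descent_sq_def by (rule sum.cong) (auto simp: indicator_def)
  with \<open>finite J\<close> show ?thesis
    by (simp add: boundary_count_in_def sum.If_cases Int_def)
qed

lemma cube_expectation_mono:
  "(\<And>x. x \<in> cube n \<Longrightarrow> f x \<le> g x) \<Longrightarrow> cube_expectation n f \<le> cube_expectation n g"
  by (simp add: cube_expectation_eq divide_right_mono sum_mono)

lemma cube_expectation_flip:
  assumes "i \<in> {1..n}"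
  shows "cube_expectation n (\<lambda>x. f (flip i x)) = cube_expectation n f"
proof -
  have ff: "flip i (flip i x) = x" for x by (simp add: flip_def fun_eq_iff)
  have "(\<Sum>x\<in>cube n. f (flip i x)) = (\<Sum>x\<in>cube n. f x)"
    by (rule sum.reindex_bij_witness[of _ "flip i" "flip i"])
      (use assms ff flip_in_cube in auto)
  then show ?thesis by (simp add: cube_expectation_eq)
qed

lemma cube_expectation_add:
  "cube_expectation n (\<lambda>x. f x + g x) = cube_expectation n f + cube_expectation n g"
  by (simp add: cube_expectation_eq sum.distrib add_divide_distrib)

lemma cube_expectation_cmult:
  "cube_expectation n (\<lambda>x. c * f x) = c * cube_expectation n f"
  by (simp add: cube_expectation_eq sum_distrib_left)

lemma cube_expectation_sum:
  "cube_expectation n (\<lambda>x. \<Sum>i\<in>I. f i x) = (\<Sum>i\<in>I. cube_expectation n (f i))"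
  unfolding cube_expectation_eq by (subst sum.swap) (simp add: sum_divide_distrib)

lemma cube_expectation_subcube_average:
  assumes "J \<subseteq> {1..n}"
  shows "cube_expectation n (subcube_average J f) = cube_expectation n f"
  using finite_subset[OF assms finite_atLeastAtMost] assms
proof (induction J rule: finite_induct)
  case empty
  show ?case by simp
next
  case (insert i J)
  have "subcube_average (insert i J) f
      = (\<lambda>x. 1/2 * (subcube_average J f x + subcube_average J f (flip i x)))"
    by (rule ext) (simp add: subcube_average_insert[OF insert.hyps])
  then have "cube_expectation n (subcube_average (insert i J) f)
      = 1/2 * cube_expectation n (\<lambda>x. subcube_average J f x + subcube_average J f (flip i x))"
    by (simp only: cube_expectation_cmult)
  also have "\<dots> = cube_expectation n (subcube_average J f)"
    using insert.prems cube_expectation_flip[of i n "subcube_average J f"]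
    by (simp add: cube_expectation_add)
  finally show ?case using insert by simp
qed

text \<open>
  The left-hand side is the mean variance of the indicator of \<open>A\<close> over the subcubes in the directions
  \<open>J\<close>. The profile \<open>t (1 - t)\<close> vanishes on indicators, so the Bobkov-type inequality retains only
  the gradient term, which is the boundary count.
\<close>

lemma talagrand_on_subcubes:
  assumes J: "J \<subseteq> {1..n}"
  shows "cube_expectation n (indicat_real A)
           - cube_expectation n (\<lambda>x. (subcube_average J (indicat_real A) x)\<^sup>2)
       \<le> cube_expectation n (\<lambda>x. sqrt (real (boundary_count_in J A x)))"
proof -
  let ?f = "indicat_real A"
  have fin: "finite J" using J finite_subset by blast
  have sq: "(?f y * (1 - ?f y))\<^sup>2 = 0" for y by (simp add: indicator_def)
  have "subcube_average J ?f x \<le> (subcube_average J ?f x)\<^sup>2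
        + subcube_average J (\<lambda>y. sqrt (real (boundary_count_in J A y))) x" for x
  proof -
    have "subcube_average J ?f x * (1 - subcube_average J ?f x)
        \<le> subcube_average J (\<lambda>y. sqrt (1/2 * real (boundary_count_in J A y))) x"
      using bobkov_type_inequality[OF fin, of ?f x]
      unfolding sq descent_sq_indicator[OF fin] by simp
    also have "\<dots> \<le> subcube_average J (\<lambda>y. sqrt (real (boundary_count_in J A y))) x"
      by (intro subcube_average_mono real_sqrt_le_mono) simp
    finally show ?thesis by (simp add: power2_eq_square algebra_simps)
  qed
  then have "cube_expectation n (subcube_average J ?f)
      \<le> cube_expectation n (\<lambda>x. (subcube_average J ?f x)\<^sup>2
        + subcube_average J (\<lambda>y. sqrt (real (boundary_count_in J A y))) x)"
    by (intro cube_expectation_mono)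
  also have "\<dots> = cube_expectation n (\<lambda>x. (subcube_average J ?f x)\<^sup>2)
        + cube_expectation n (\<lambda>y. sqrt (real (boundary_count_in J A y)))"
    unfolding cube_expectation_add cube_expectation_subcube_average[OF J] ..
  finally show ?thesis
    unfolding cube_expectation_subcube_average[OF J] by simp
qed

section \<open>Fourier expansion\<close>

text \<open>
  The sum over \<open>S\<close> is the expanded product of the factors \<open>1 + x i * y i\<close>, each of which is 2
  or 0 according to whether \<open>x\<close> and \<open>y\<close> agree at \<open>i\<close>.
\<close>

lemma sum_characters:
  assumes "x \<in> cube n" "y \<in> cube n"
  shows "(\<Sum>S\<in>Pow {1..n}. character S x * character S y) = (if x = y then 2 ^ n else 0)"
proof -
  have "(\<Sum>S\<in>Pow {1..n}. character S x * character S y) = (\<Prod>i\<in>{1..n}. x i * y i + 1)"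
    by (subst prod_add) (simp_all add: character_def prod.distrib)
  also have "\<dots> = (if x = y then 2 ^ n else 0)"
  proof (cases "x = y")
    case True
    have "x i * x i + 1 = 2" if "i \<in> {1..n}" for i
    proof -
      have "x i = -1 \<or> x i = 1" using assms(1) that by (auto simp: cube_def PiE_iff)
      then show ?thesis by auto
    qed
    then have "(\<Prod>i\<in>{1..n}. x i * x i + 1) = (\<Prod>i\<in>{1..n}. 2)"
      by (intro prod.cong) auto
    with True show ?thesis by simp
  next
    case False
    then obtain i where i: "i \<in> {1..n}" "x i \<noteq> y i"
      using PiE_ext[of x "{1..n}" "\<lambda>_. {-1,1}" y] assms by (auto simp: cube_def)
    have "(x i = -1 \<or> x i = 1) \<and> (y i = -1 \<or> y i = 1)"
      using assms i(1) by (auto simp: cube_def PiE_iff)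
    with i(2) have "x i * y i + 1 = 0" by auto
    with i(1) have "\<exists>i\<in>{1..n}. x i * y i + 1 = 0" by blast
    then have "(\<Prod>i\<in>{1..n}. x i * y i + 1) = 0" by simp
    with False show ?thesis by simp
  qed
  finally show ?thesis .
qed

lemma parseval:
  "(\<Sum>S\<in>Pow {1..n}. (fourier_coeff n g S)\<^sup>2) = cube_expectation n (\<lambda>x. (g x)\<^sup>2)"
proof -
  have "(\<Sum>S\<in>Pow {1..n}. (fourier_coeff n g S)\<^sup>2)
      = (\<Sum>S\<in>Pow {1..n}. (\<Sum>x\<in>cube n. \<Sum>y\<in>cube n. g x * g y * (character S x * character S y))) / 4 ^ n"
    by (simp add: fourier_coeff_def cube_expectation_eq power2_eq_square sum_product
        sum_divide_distrib power_mult_distrib[symmetric] mult_ac)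
  also have "(\<Sum>S\<in>Pow {1..n}. (\<Sum>x\<in>cube n. \<Sum>y\<in>cube n. g x * g y * (character S x * character S y)))
     = (\<Sum>x\<in>cube n. \<Sum>y\<in>cube n. \<Sum>S\<in>Pow {1..n}. g x * g y * (character S x * character S y))"
    by (subst sum.swap, rule sum.cong[OF refl], rule sum.swap)
  also have "\<dots> = (\<Sum>x\<in>cube n. \<Sum>y\<in>cube n. g x * g y * (if x = y then 2 ^ n else 0))"
    by (intro sum.cong refl) (simp only: sum_distrib_left[symmetric] sum_characters)
  also have "\<dots> = (\<Sum>x\<in>cube n. (g x)\<^sup>2 * 2 ^ n)"
    by (intro sum.cong refl) (simp add: if_distrib[of "\<lambda>t. _ * t"] finite_cube power2_eq_square cong: if_cong)
  also have "\<dots> / 4 ^ n = cube_expectation n (\<lambda>x. (g x)\<^sup>2)"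
  proof -
    have "(4::real) ^ n = 2 ^ n * 2 ^ n" by (simp add: power_mult_distrib[symmetric])
    then show ?thesis by (simp add: cube_expectation_eq sum_distrib_right[symmetric])
  qed
  finally show ?thesis .
qed

lemma character_flip:
  assumes "finite S"
  shows "character S (flip i x) = (if i \<in> S then - character S x else character S x)"
proof (cases "i \<in> S")
  case True
  then have "S = insert i (S - {i})" by blast
  then have "character S z = z i * (\<Prod>j\<in>S - {i}. z j)" for z :: "nat \<Rightarrow> real"
    using assms True by (simp add: character_def prod.remove)
  moreover have "(\<Prod>j\<in>S - {i}. flip i x j) = (\<Prod>j\<in>S - {i}. x j)"
    by (rule prod.cong) (auto simp: flip_def)
  ultimately show ?thesis using True by (simp add: flip_def)
next
  case False
  then have "(\<Prod>j\<in>S. flip i x j) = (\<Prod>j\<in>S. x j)"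
    by (intro prod.cong) (auto simp: flip_def)
  with False show ?thesis by (simp add: character_def)
qed

lemma fourier_coeff_flip:
  assumes "i \<in> {1..n}" "finite S"
  shows "fourier_coeff n (\<lambda>x. g (flip i x)) S
       = (if i \<in> S then - fourier_coeff n g S else fourier_coeff n g S)"
proof -
  have ff: "flip i (flip i x) = x" for x by (simp add: flip_def fun_eq_iff)
  have "fourier_coeff n (\<lambda>x. g (flip i x)) S
      = cube_expectation n (\<lambda>x. g x * character S (flip i x))"
    using cube_expectation_flip[OF assms(1), of "\<lambda>x. g x * character S (flip i x)"]
    by (simp add: fourier_coeff_def ff)
  then show ?thesis
    by (simp add: character_flip[OF assms(2)] fourier_coeff_def cube_expectation_eq sum_negf)
qed

lemma fourier_coeff_subcube_average:
  assumes "J \<subseteq> {1..n}" "finite S"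
  shows "fourier_coeff n (subcube_average J g) S = (if S \<inter> J = {} then fourier_coeff n g S else 0)"
  using finite_subset[OF assms(1) finite_atLeastAtMost] assms(1)
proof (induction J rule: finite_induct)
  case empty
  show ?case by simp
next
  case (insert i J)
  let ?g = "subcube_average J g"
  have "fourier_coeff n (subcube_average (insert i J) g) S
      = cube_expectation n (\<lambda>x. 1/2 * (?g x * character S x + ?g (flip i x) * character S x))"
    by (simp add: fourier_coeff_def subcube_average_insert[OF insert.hyps] algebra_simps add_divide_distrib)
  also have "\<dots> = 1/2 * (fourier_coeff n ?g S + fourier_coeff n (\<lambda>x. ?g (flip i x)) S)"
    unfolding cube_expectation_cmult cube_expectation_add fourier_coeff_def ..
  also have "\<dots> = (if i \<in> S then 0 else fourier_coeff n ?g S)"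
    using insert.prems by (subst fourier_coeff_flip) (use assms in auto)
  finally show ?case using insert by auto
qed

text \<open>
  By Parseval, applied to the indicator and to its \<open>J\<close>-average, the mean variance over the subcubes in
  the directions \<open>J\<close> is the Fourier weight on the sets that meet \<open>J\<close>.
\<close>

lemma fourier_weight_meeting_le:
  assumes J: "J \<subseteq> {1..n}"
  shows "(\<Sum>S\<in>Pow {1..n}. (if S \<inter> J = {} then 0 else 1) * (fourier_coeff n (indicat_real A) S)\<^sup>2)
       \<le> cube_expectation n (\<lambda>x. sqrt (real (boundary_count_in J A x)))"
proof -
  let ?c = "fourier_coeff n (indicat_real A)"
  have ind: "(indicat_real A x)\<^sup>2 = indicat_real A x" for x by (simp add: indicator_def)
  have "cube_expectation n (\<lambda>x. (subcube_average J (indicat_real A) x)\<^sup>2)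
      = (\<Sum>S\<in>Pow {1..n}. (if S \<inter> J = {} then ?c S else 0)\<^sup>2)"
    unfolding parseval[symmetric]
    by (intro sum.cong refl) (simp add: fourier_coeff_subcube_average[OF J] finite_subset)
  moreover have "cube_expectation n (indicat_real A) = (\<Sum>S\<in>Pow {1..n}. (?c S)\<^sup>2)"
    unfolding parseval ind ..
  ultimately have "(\<Sum>S\<in>Pow {1..n}. (if S \<inter> J = {} then 0 else 1) * (?c S)\<^sup>2)
     = cube_expectation n (indicat_real A)
        - cube_expectation n (\<lambda>x. (subcube_average J (indicat_real A) x)\<^sup>2)"
    by (auto simp: sum_subtractf[symmetric] intro!: sum.cong)
  with talagrand_on_subcubes[OF J, of A] show ?thesis by simp
qed

section \<open>Random sets of coordinates\<close>

text \<open>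
  For \<open>J \<subseteq> {1..n}\<close>, the probability that a random subset of \<open>{1..n}\<close>, containing each element
  independently with probability \<open>p\<close>, equals \<open>J\<close>.
\<close>

definition binomial_weight :: "nat \<Rightarrow> real \<Rightarrow> nat set \<Rightarrow> real" where
  "binomial_weight n p J = p ^ card J * (1 - p) ^ card ({1..n} - J)"

lemma binomial_weight_nonneg: "0 \<le> p \<Longrightarrow> p \<le> 1 \<Longrightarrow> 0 \<le> binomial_weight n p J"
  by (simp add: binomial_weight_def)

lemma sum_binomial_weight: "(\<Sum>J\<in>Pow {1..n}. binomial_weight n p J) = 1"
proof -
  have "(\<Prod>i\<in>{1..n}. p + (1 - p)) = (\<Sum>J\<in>Pow {1..n}. binomial_weight n p J)"
    by (subst prod_add) (simp_all add: binomial_weight_def)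
  then show ?thesis by simp
qed

text \<open>
  Replacing the weight \<open>p\<close> of the elements of \<open>S\<close> by 0 in the product expansion of the total mass
  removes exactly the sets \<open>J\<close> that meet \<open>S\<close>.
\<close>

lemma sum_binomial_weight_disjoint:
  assumes "S \<subseteq> {1..n}"
  shows "(\<Sum>J\<in>Pow {1..n}. binomial_weight n p J * (if S \<inter> J = {} then 1 else 0)) = (1 - p) ^ card S"
proof -
  have fin: "finite S" using assms finite_subset by blast
  have "(\<Prod>i\<in>J. if i \<in> S then 0 else p) = p ^ card J * (if S \<inter> J = {} then 1 else 0)"
    if "finite J" for J
  proof (cases "S \<inter> J = {}")
    case True
    then have "(\<Prod>i\<in>J. if i \<in> S then 0 else p) = (\<Prod>i\<in>J. p)" by (intro prod.cong) auto
    with True show ?thesis by simp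
  next
    case False
    then have "\<exists>i\<in>J. (if i \<in> S then 0 else p) = 0" by auto
    with that have "(\<Prod>i\<in>J. if i \<in> S then 0 else p) = 0" by (simp only: prod_zero)
    with False show ?thesis by simp
  qed
  then have "(\<Sum>J\<in>Pow {1..n}. binomial_weight n p J * (if S \<inter> J = {} then 1 else 0))
     = (\<Sum>J\<in>Pow {1..n}. (\<Prod>i\<in>J. if i \<in> S then 0 else p) * (\<Prod>i\<in>{1..n} - J. 1 - p))"
    by (intro sum.cong refl) (auto simp: binomial_weight_def finite_subset)
  also have "\<dots> = (\<Prod>i\<in>{1..n}. (if i \<in> S then 0 else p) + (1 - p))"
    by (subst prod_add) simp_all
  also have "\<dots> = (\<Prod>i\<in>{1..n}. if i \<in> S then 1 - p else 1)"
    by (intro prod.cong) auto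
  also have "\<dots> = (1 - p) ^ card S"
    using assms by (simp add: prod.If_cases Int_absorb1)
  finally show ?thesis .
qed

lemma sum_binomial_weight_meeting:
  assumes "S \<subseteq> {1..n}"
  shows "(\<Sum>J\<in>Pow {1..n}. binomial_weight n p J * (if S \<inter> J = {} then 0 else 1)) = 1 - (1 - p) ^ card S"
proof -
  have "(\<Sum>J\<in>Pow {1..n}. binomial_weight n p J * (if S \<inter> J = {} then 0 else 1))
     = (\<Sum>J\<in>Pow {1..n}. binomial_weight n p J)
     - (\<Sum>J\<in>Pow {1..n}. binomial_weight n p J * (if S \<inter> J = {} then 1 else 0))"
    by (auto simp: sum_subtractf[symmetric] intro!: sum.cong)
  then show ?thesis by (simp only: sum_binomial_weight sum_binomial_weight_disjoint[OF assms])
qed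

lemma sum_binomial_weight_card:
  assumes "H \<subseteq> {1..n}"
  shows "(\<Sum>J\<in>Pow {1..n}. binomial_weight n p J * real (card (H \<inter> J))) = p * real (card H)"
proof -
  have fin: "finite H" using assms finite_subset by blast
  have "real (card (H \<inter> J)) = (\<Sum>i\<in>H. if {i} \<inter> J = {} then 0 else 1)" for J
  proof -
    have "(\<Sum>i\<in>H. if {i} \<inter> J = {} then 0 else 1 :: real) = (\<Sum>i\<in>H. if i \<in> J then 1 else 0)"
      by (intro sum.cong) auto
    then show ?thesis using fin by (simp add: sum.If_cases Int_def)
  qed
  then have "(\<Sum>J\<in>Pow {1..n}. binomial_weight n p J * real (card (H \<inter> J)))
     = (\<Sum>J\<in>Pow {1..n}. \<Sum>i\<in>H. binomial_weight n p J * (if {i} \<inter> J = {} then 0 else 1))"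
    by (simp only: sum_distrib_left)
  also have "\<dots> = (\<Sum>i\<in>H. \<Sum>J\<in>Pow {1..n}. binomial_weight n p J * (if {i} \<inter> J = {} then 0 else 1))"
    by (rule sum.swap)
  also have "\<dots> = (\<Sum>i\<in>H. p)"
  proof (rule sum.cong[OF refl])
    fix i assume "i \<in> H"
    then have "{i} \<subseteq> {1..n}" using assms by auto
    from sum_binomial_weight_meeting[OF this, of p]
    show "(\<Sum>J\<in>Pow {1..n}. binomial_weight n p J * (if {i} \<inter> J = {} then 0 else 1)) = p" by simp
  qed
  finally show ?thesis by simp
qed

text \<open>
  The first bound is Cauchy-Schwarz; the second holds since \<open>sqrt m \<le> m\<close> for integers \<open>m\<close>. The second
  bound is the better one when \<open>p * card H < 1\<close>, and it is what makes the sum over small \<open>p\<close>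
  converge for \<open>\<alpha> \<ge> 1/2\<close>.
\<close>

lemma average_sqrt_card_le:
  assumes H: "H \<subseteq> {1..n}" and p: "0 \<le> p" "p \<le> 1"
  shows "(\<Sum>J\<in>Pow {1..n}. binomial_weight n p J * sqrt (real (card (H \<inter> J))))
       \<le> min (sqrt (p * real (card H))) (p * real (card H))"
proof -
  let ?w = "binomial_weight n p" and ?m = "\<lambda>J. real (card (H \<inter> J))"
  have w: "0 \<le> ?w J" for J using p by (rule binomial_weight_nonneg)
  have "(\<Sum>J\<in>Pow {1..n}. sqrt (?w J) * sqrt (?w J * ?m J))\<^sup>2
      \<le> (\<Sum>J\<in>Pow {1..n}. (sqrt (?w J))\<^sup>2) * (\<Sum>J\<in>Pow {1..n}. (sqrt (?w J * ?m J))\<^sup>2)"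
    by (rule Cauchy_Schwarz_ineq_sum)
  also have "\<dots> = (\<Sum>J\<in>Pow {1..n}. ?w J) * (\<Sum>J\<in>Pow {1..n}. ?w J * ?m J)"
    using w by simp
  also have "\<dots> = p * real (card H)"
    by (simp only: sum_binomial_weight sum_binomial_weight_card[OF H] mult_1)
  also have "(\<Sum>J\<in>Pow {1..n}. sqrt (?w J) * sqrt (?w J * ?m J)) = (\<Sum>J\<in>Pow {1..n}. ?w J * sqrt (?m J))"
    using w by (simp add: real_sqrt_mult mult.assoc[symmetric])
  finally have 1: "(\<Sum>J\<in>Pow {1..n}. ?w J * sqrt (?m J)) \<le> sqrt (p * real (card H))"
    by (rule real_le_rsqrt)
  have "sqrt (real m) \<le> real m" for m :: nat
  proof -
    have "real m \<le> (real m)\<^sup>2"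
      by (cases m) (simp_all add: power2_eq_square)
    then show ?thesis by (intro real_le_lsqrt) auto
  qed
  then have "(\<Sum>J\<in>Pow {1..n}. ?w J * sqrt (?m J)) \<le> (\<Sum>J\<in>Pow {1..n}. ?w J * ?m J)"
    by (intro sum_mono mult_left_mono w)
  also have "\<dots> = p * real (card H)"
    by (rule sum_binomial_weight_card[OF H])
  finally show ?thesis using 1 by (rule min.boundedI[rotated])
qed

text \<open>
  The factor \<open>1 - (1 - p) ^ card S\<close> is the probability that \<open>S\<close> meets the random set \<open>J\<close>, so this is the
  mean over \<open>J\<close> of the bounds for fixed \<open>J\<close>. The left-hand side is the probability that a uniform
  point lies in \<open>A\<close> and leaves it when each coordinate is rerandomised with probability \<open>p\<close>.
\<close>

lemma noise_sensitivity_le: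
  assumes p: "0 \<le> p" "p \<le> 1"
  shows "(\<Sum>S\<in>Pow {1..n}. (1 - (1 - p) ^ card S) * (fourier_coeff n (indicat_real A) S)\<^sup>2)
       \<le> cube_expectation n (\<lambda>x. min (sqrt (p * real (boundary_count n A x))) (p * real (boundary_count n A x)))"
proof -
  let ?w = "binomial_weight n p" and ?c = "fourier_coeff n (indicat_real A)"
  have "(\<Sum>S\<in>Pow {1..n}. (1 - (1 - p) ^ card S) * (?c S)\<^sup>2)
      = (\<Sum>S\<in>Pow {1..n}. \<Sum>J\<in>Pow {1..n}. ?w J * ((if S \<inter> J = {} then 0 else 1) * (?c S)\<^sup>2))"
    by (intro sum.cong refl)
      (simp add: sum_binomial_weight_meeting[symmetric] sum_distrib_right mult.assoc)
  also have "\<dots> = (\<Sum>J\<in>Pow {1..n}. ?w J * (\<Sum>S\<in>Pow {1..n}. (if S \<inter> J = {} then 0 else 1) * (?c S)\<^sup>2))"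
    by (subst sum.swap) (simp only: sum_distrib_left)
  also have "\<dots> \<le> (\<Sum>J\<in>Pow {1..n}. ?w J * cube_expectation n (\<lambda>x. sqrt (real (boundary_count_in J A x))))"
    by (intro sum_mono mult_left_mono fourier_weight_meeting_le binomial_weight_nonneg p) auto
  also have "\<dots> = cube_expectation n (\<lambda>x. \<Sum>J\<in>Pow {1..n}. ?w J * sqrt (real (boundary_count_in J A x)))"
    by (simp only: cube_expectation_sum cube_expectation_cmult)
  also have "\<dots> \<le> cube_expectation n (\<lambda>x. min (sqrt (p * real (boundary_count n A x))) (p * real (boundary_count n A x)))"
  proof (rule cube_expectation_mono)
    fix x
    let ?H = "{i \<in> {1..n}. x \<in> A \<and> flip i x \<notin> A}"
    have "boundary_count_in J A x = card (?H \<inter> J)" if "J \<in> Pow {1..n}" for J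
      unfolding boundary_count_in_def by (rule arg_cong[of _ _ card]) (use that in auto)
    then have "(\<Sum>J\<in>Pow {1..n}. ?w J * sqrt (real (boundary_count_in J A x)))
        = (\<Sum>J\<in>Pow {1..n}. ?w J * sqrt (real (card (?H \<inter> J))))"
      by (intro sum.cong refl) simp
    also have "\<dots> \<le> min (sqrt (p * real (card ?H))) (p * real (card ?H))"
      by (rule average_sqrt_card_le[OF _ p]) auto
    finally show "(\<Sum>J\<in>Pow {1..n}. ?w J * sqrt (real (boundary_count_in J A x)))
       \<le> min (sqrt (p * real (boundary_count n A x))) (p * real (boundary_count n A x))"
      by (simp only: boundary_count_def)
  qed
  finally show ?thesis .
qed

section \<open>Summation over dyadic noise levels\<close>

text \<open>
  The single term with \<open>2 ^ k \<le> m < 2 ^ (k + 1)\<close> suffices: there \<open>(1/2) ^ k * m \<ge> 1\<close>, so the second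
  factor is at least \<open>1 - exp (-1) \<ge> 1/2\<close>. Cutting off at \<open>k \<le> n\<close> keeps this term because
  \<open>k < 2 ^ k \<le> m \<le> n\<close>.
\<close>

lemma powr_le_dyadic_sum:
  assumes "0 < \<alpha>" "\<alpha> < 1" "1 \<le> m" "m \<le> n"
  shows "real m powr \<alpha> \<le> 4 * (\<Sum>k\<le>n. (2 powr \<alpha>) ^ k * (1 - (1 - (1/2) ^ k) ^ m))"
proof -
  obtain k where k: "2 ^ k \<le> m" "m < 2 ^ (k + 1)"
    using ex_power_ivl1[of 2 m] assms(3) by auto
  have "k < 2 ^ k" by simp
  with k(1) assms(4) have kn: "k \<le> n" by linarith
  let ?p = "(1/2 :: real) ^ k"
  have p: "0 \<le> ?p" "?p \<le> 1" by (auto simp: power_le_one)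
  have "real (2 ^ k) \<le> real m" using k(1) of_nat_mono by blast
  then have pm: "1 \<le> ?p * real m" by (simp add: power_divide field_simps)
  have "(1 - ?p) ^ m \<le> exp (- ?p) ^ m"
    using p exp_ge_add_one_self[of "- ?p"] by (intro power_mono) auto
  also have "\<dots> = exp (- (?p * real m))"
    by (simp add: exp_of_nat_mult[symmetric] mult.commute)
  also have "\<dots> \<le> exp (-1)" using pm by simp
  also have "\<dots> \<le> 1/2"
    using exp_ge_add_one_self[of 1] by (simp add: exp_minus field_simps)
  finally have half: "1/2 \<le> 1 - (1 - ?p) ^ m" by simp
  have r: "2 powr \<alpha> \<le> 2" using powr_mono[of \<alpha> 1 2] assms(2) by simp
  have "real m < real (2 ^ (k + 1))" using k(2) of_nat_less_iff by blast
  then have "real m powr \<alpha> \<le> (2 ^ (k + 1)) powr \<alpha>"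
    using assms by (intro powr_mono2) auto
  also have "\<dots> = 2 powr \<alpha> * (2 powr \<alpha>) ^ k"
    by (simp add: powr_mult powr_power[symmetric] powr_realpow[symmetric] powr_powr mult.commute)
  also have "\<dots> \<le> 2 * (2 powr \<alpha>) ^ k"
    using r by (intro mult_right_mono) auto
  also have "\<dots> \<le> 4 * ((2 powr \<alpha>) ^ k * (1 - (1 - ?p) ^ m))"
    using mult_left_mono[OF half, of "(2 powr \<alpha>) ^ k"] by simp
  also have "\<dots> \<le> 4 * (\<Sum>k\<le>n. (2 powr \<alpha>) ^ k * (1 - (1 - (1/2) ^ k) ^ m))"
    using kn by (intro mult_left_mono member_le_sum) (auto simp: power_le_one)
  finally show ?thesis .
qed

lemma powr_power_two: "(2 powr a) ^ k = (2 ^ k :: real) powr a"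
  by (simp add: powr_realpow[symmetric] powr_powr mult.commute)

text \<open>
  Up to the threshold \<open>K\<close>, where \<open>(1/2) ^ k * h \<ge> 1\<close>, the square root is the smaller entry of the
  minimum; beyond it the linear entry is, and the terms decay geometrically because \<open>\<alpha> < 1\<close>. The tail is
  therefore governed by its first term, of size \<open>h * h powr (\<alpha> - 1)\<close>.
\<close>

lemma dyadic_sum_le_head_plus_tail:
  assumes "\<alpha> < 1" "2 ^ K \<le> h" "h < 2 ^ (K + 1)"
  shows "(\<Sum>k\<le>n. (2 powr \<alpha>) ^ k * min (sqrt ((1/2) ^ k * real h)) ((1/2) ^ k * real h))
       \<le> sqrt (real h) * (\<Sum>k\<le>K. (2 powr (\<alpha> - 1/2)) ^ k) + real h powr \<alpha> / (1 - 2 powr (\<alpha> - 1))"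
proof -
  let ?t = "\<lambda>k. (2 powr \<alpha>) ^ k * min (sqrt ((1/2) ^ k * real h)) ((1/2) ^ k * real h)"
  let ?q = "2 powr (\<alpha> - 1/2) :: real" and ?s = "2 powr (\<alpha> - 1) :: real"
  have h: "0 < h" using assms(2) by (metis gr0I not_numeral_le_zero power_not_zero le_zero_eq zero_neq_numeral)
  have s: "0 < ?s" "?s < 1" using assms(1) powr_less_mono[of "\<alpha> - 1" 0 2] by auto
  have sqrt2: "sqrt ((1/2) ^ k) = (2 powr (-1/2)) ^ k" for k :: nat
    by (simp add: real_sqrt_power powr_minus powr_half_sqrt real_sqrt_divide power_divide divide_simps)
  have head: "?t k \<le> sqrt (real h) * ?q ^ k" for k
  proof -
    have "?t k \<le> (2 powr \<alpha>) ^ k * sqrt ((1/2) ^ k * real h)" by (intro mult_left_mono) auto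
    also have "\<dots> = sqrt (real h) * (2 powr \<alpha> * 2 powr (-1/2)) ^ k"
      by (simp add: real_sqrt_mult sqrt2 power_mult_distrib)
    also have "2 powr \<alpha> * 2 powr (-1/2) = ?q" by (simp add: powr_add[symmetric])
    finally show ?thesis .
  qed
  have tail: "?t k \<le> real h * ?s ^ k" for k
  proof -
    have "?t k \<le> (2 powr \<alpha>) ^ k * ((1/2) ^ k * real h)" by (intro mult_left_mono) auto
    also have "\<dots> = real h * (2 powr \<alpha> * (1/2)) ^ k"
      by (simp only: power_mult_distrib mult_ac)
    also have "2 powr \<alpha> * (1/2) = ?s" by (simp add: powr_diff)
    finally show ?thesis .
  qed
  have t0: "0 \<le> ?t k" for k by simp
  \<comment> \<open>Enlarging the range makes the tail interval nonempty even when \<open>n \<le> K\<close>.\<close>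
  have "(\<Sum>k\<le>n. ?t k) \<le> (\<Sum>k\<le>K + 1 + n. ?t k)" by (intro sum_mono2) auto
  also have "{..K + 1 + n} = {..K} \<union> {K + 1..K + 1 + n}" by auto
  also have "sum ?t \<dots> = (\<Sum>k\<le>K. ?t k) + (\<Sum>k\<in>{K + 1..K + 1 + n}. ?t k)"
    by (intro sum.union_disjoint) auto
  also have "\<dots> \<le> (\<Sum>k\<le>K. sqrt (real h) * ?q ^ k) + (\<Sum>k\<in>{K + 1..K + 1 + n}. real h * ?s ^ k)"
    by (intro add_mono sum_mono head tail)
  also have "(\<Sum>k\<le>K. sqrt (real h) * ?q ^ k) = sqrt (real h) * (\<Sum>k\<le>K. ?q ^ k)"
    by (simp only: sum_distrib_left)
  also have "(\<Sum>k\<in>{K + 1..K + 1 + n}. real h * ?s ^ k) \<le> real h powr \<alpha> / (1 - ?s)"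
  proof -
    have "(1 - ?s) * (\<Sum>k\<in>{K + 1..K + 1 + n}. ?s ^ k) \<le> ?s ^ (K + 1)"
      using s by (subst sum_gp_multiplied) auto
    also have "\<dots> = (2 ^ (K + 1)) powr (\<alpha> - 1)" by (rule powr_power_two)
    also have "\<dots> \<le> real h powr (\<alpha> - 1)"
    proof (rule powr_mono2')
      have "real h < real (2 ^ (K + 1))" using assms(3) of_nat_less_iff by blast
      then show "real h \<le> 2 ^ (K + 1)" by simp
    qed (use assms h in auto)
    finally have "real h * ((1 - ?s) * (\<Sum>k\<in>{K + 1..K + 1 + n}. ?s ^ k)) \<le> real h * real h powr (\<alpha> - 1)"
      by (intro mult_left_mono) auto
    also have "\<dots> = real h powr \<alpha>" using h by (simp add: powr_diff)
    finally show ?thesis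
      using s by (simp add: sum_distrib_left[symmetric] field_simps)
  qed
  finally show ?thesis by simp
qed

text \<open>
  The head is \<open>sqrt h\<close> times a geometric sum with ratio \<open>2 powr (\<alpha> - 1/2)\<close> and about \<open>log 2 h\<close> terms.
  It is bounded for \<open>\<alpha> < 1/2\<close>, equals the number of terms for \<open>\<alpha> = 1/2\<close>, and is dominated by
  its last term, of size at most \<open>h powr (\<alpha> - 1/2)\<close>, for \<open>\<alpha> > 1/2\<close>. The tail \<open>h powr \<alpha>\<close> is at most
  \<open>omega \<alpha> h\<close> in every regime.
\<close>

lemma dyadic_sum_le_omega:
  assumes "0 < \<alpha>" "\<alpha> < 1"
  obtains C where "0 \<le> C" "\<And>n h. (\<Sum>k\<le>n. (2 powr \<alpha>) ^ k * min (sqrt ((1/2) ^ k * real h)) ((1/2) ^ k * real h))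
       \<le> C * omega \<alpha> h"
proof -
  let ?q = "2 powr (\<alpha> - 1/2) :: real" and ?s = "2 powr (\<alpha> - 1) :: real"
  let ?T = "\<lambda>n h. \<Sum>k\<le>n. (2 powr \<alpha>) ^ k * min (sqrt ((1/2) ^ k * real h)) ((1/2) ^ k * real h)"
  have s: "0 < ?s" "?s < 1" using assms powr_less_mono[of "\<alpha> - 1" 0 2] by auto
  have lne: "1 \<le> ln (exp 1 + real h)" for h :: nat
    by (subst ln_ge_iff) (auto intro: add_pos_nonneg)
  have tail: "real h powr \<alpha> \<le> omega \<alpha> h" if "1 \<le> h" for h
  proof -
    have le: "real h powr \<alpha> \<le> sqrt (real h)" if "\<alpha> \<le> 1/2"
      using that powr_mono[of \<alpha> "1/2" "real h"] \<open>1 \<le> h\<close> by (simp add: powr_half_sqrt)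
    have "sqrt (real h) * 1 \<le> sqrt (real h) * ln (exp 1 + real h)"
      by (intro mult_left_mono lne) auto
    then have "real h powr \<alpha> \<le> sqrt (real h) * ln (exp 1 + real h)" if "\<alpha> \<le> 1/2"
      using le[OF that] by linarith
    with le that show ?thesis by (auto simp: omega_def)
  qed
  have head: "\<exists>B\<ge>0. \<forall>h K. 2 ^ K \<le> h \<longrightarrow> sqrt (real h) * (\<Sum>k\<le>K. ?q ^ k) \<le> B * omega \<alpha> h"
  proof -
    consider "\<alpha> < 1/2" | "\<alpha> = 1/2" | "\<alpha> > 1/2" by linarith
    then show ?thesis
    proof cases
      case 1
      have q: "0 < ?q" "?q < 1" using 1 powr_less_mono[of "\<alpha> - 1/2" 0 2] by auto
      have "sqrt (real h) * (\<Sum>k\<le>K. ?q ^ k) \<le> 1 / (1 - ?q) * omega \<alpha> h" if "2 ^ K \<le> h" for h K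
      proof -
        have "h \<noteq> 0" using that by (metis le_zero_eq power_not_zero zero_neq_numeral)
        then have om: "omega \<alpha> h = sqrt (real h)" using 1 by (simp add: omega_def)
        have "(\<Sum>k\<le>K. ?q ^ k) = (1 - ?q ^ Suc K) / (1 - ?q)"
          using q 1 sum_gp0[of ?q K] by simp
        also have "\<dots> \<le> 1 / (1 - ?q)" using q by (intro divide_right_mono) auto
        finally show ?thesis unfolding om by (subst mult.commute) (intro mult_right_mono, auto)
      qed
      moreover have "0 \<le> 1 / (1 - ?q)" using q by simp
      ultimately show ?thesis by blast
    next
      case 2
      have "sqrt (real h) * (\<Sum>k\<le>K. ?q ^ k) \<le> 3 * omega \<alpha> h" if "2 ^ K \<le> h" for h K
      proof -
        have h: "h \<noteq> 0" using that by (metis le_zero_eq power_not_zero zero_neq_numeral)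
        have "real (2 ^ K) \<le> real h" using that of_nat_mono by blast
        then have "ln (2 ^ K) \<le> ln (real h)" using h by (subst ln_le_cancel_iff) auto
        also have "\<dots> \<le> ln (exp 1 + real h)" using h by (subst ln_le_cancel_iff) (auto intro: add_pos_nonneg)
        finally have "real K * ln 2 \<le> ln (exp 1 + real h)" by (simp add: ln_realpow)
        moreover have "real K * (1/2) \<le> real K * ln 2"
          using ln2_ge_two_thirds by (intro mult_left_mono) auto
        ultimately have "1 + real K \<le> 3 * ln (exp 1 + real h)" using lne[of h] by linarith
        then have bound: "sqrt (real h) * (1 + real K) \<le> sqrt (real h) * (3 * ln (exp 1 + real h))"
          by (intro mult_left_mono) auto
        have "?q = 1" using 2 by simp
        then have geo: "(\<Sum>k\<le>K. ?q ^ k) = 1 + real K"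
          by (simp only: power_one sum_constant) simp
        have om: "omega \<alpha> h = sqrt (real h) * ln (exp 1 + real h)"
          using 2 h by (simp add: omega_def)
        show ?thesis
          unfolding geo om using bound by (simp only: mult.left_commute)
      qed
      then show ?thesis by (intro exI[of _ 3] conjI allI impI) auto
    next
      case 3
      have q: "1 < ?q" using 3 powr_less_mono[of 0 "\<alpha> - 1/2" 2] by auto
      have "sqrt (real h) * (\<Sum>k\<le>K. ?q ^ k) \<le> ?q / (?q - 1) * omega \<alpha> h" if "2 ^ K \<le> h" for h K
      proof -
        have h: "h \<noteq> 0" using that by (metis le_zero_eq power_not_zero zero_neq_numeral)
        have "real (2 ^ K) \<le> real h" using that of_nat_mono by blast
        then have "?q ^ K \<le> real h powr (\<alpha> - 1/2)"
          unfolding powr_power_two using 3 by (intro powr_mono2) auto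
        then have "?q * ?q ^ K \<le> ?q * real h powr (\<alpha> - 1/2)" by (intro mult_left_mono) auto
        then have num: "?q * ?q ^ K - 1 \<le> ?q * real h powr (\<alpha> - 1/2)" by linarith
        have "(\<Sum>k\<le>K. ?q ^ k) = (?q * ?q ^ K - 1) / (?q - 1)"
        proof -
          have "(\<Sum>k\<le>K. ?q ^ k) = (1 - ?q * ?q ^ K) / (1 - ?q)"
            using q 3 sum_gp0[of ?q K] by simp
          also have "\<dots> = (?q * ?q ^ K - 1) / (?q - 1)"
            by (metis minus_diff_eq minus_divide_divide)
          finally show ?thesis .
        qed
        also have "\<dots> \<le> ?q * real h powr (\<alpha> - 1/2) / (?q - 1)"
          using q by (intro divide_right_mono num) auto
        finally have "sqrt (real h) * (\<Sum>k\<le>K. ?q ^ k)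
           \<le> sqrt (real h) * (?q * real h powr (\<alpha> - 1/2) / (?q - 1))"
          by (intro mult_left_mono) auto
        also have "\<dots> = ?q / (?q - 1) * (real h powr (1/2) * real h powr (\<alpha> - 1/2))"
          by (simp add: powr_half_sqrt)
        also have "real h powr (1/2) * real h powr (\<alpha> - 1/2) = omega \<alpha> h"
          using 3 h by (simp add: omega_def powr_add[symmetric])
        finally show ?thesis .
      qed
      moreover have "0 \<le> ?q / (?q - 1)" using q by simp
      ultimately show ?thesis by blast
    qed
  qed
  then obtain B where B: "0 \<le> B"
    "\<And>h K. 2 ^ K \<le> h \<Longrightarrow> sqrt (real h) * (\<Sum>k\<le>K. ?q ^ k) \<le> B * omega \<alpha> h" by blast
  have "?T n h \<le> (B + 1 / (1 - ?s)) * omega \<alpha> h" for n h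
  proof (cases "h = 0")
    case True
    then show ?thesis by (simp add: omega_def)
  next
    case False
    then obtain K where K: "2 ^ K \<le> h" "h < 2 ^ (K + 1)"
      using ex_power_ivl1[of 2 h] by auto
    have "real h powr \<alpha> / (1 - ?s) \<le> omega \<alpha> h / (1 - ?s)"
      using tail[of h] False s by (intro divide_right_mono) auto
    with dyadic_sum_le_head_plus_tail[OF assms(2) K, of n] B(2)[OF K(1)]
    show ?thesis by (simp add: algebra_simps)
  qed
  moreover have "0 \<le> B + 1 / (1 - ?s)" using B(1) s by simp
  ultimately show ?thesis using that by blast
qed

lemma fractional_fourier_weight_le:
  fixes \<alpha> :: real
  assumes "0 < \<alpha>" "\<alpha> < 1"
  shows "\<exists>C. \<forall>n A. (\<Sum>S \<in> Pow {1..n} - {{}}. real (card S) powr \<alpha> * (fourier_coeff n (indicat_real A) S)\<^sup>2)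
                \<le> C * cube_expectation n (\<lambda>x. omega \<alpha> (boundary_count n A x))"
proof -
  obtain C where C: "0 \<le> C" "\<And>n h. (\<Sum>k\<le>n. (2 powr \<alpha>) ^ k * min (sqrt ((1/2) ^ k * real h)) ((1/2) ^ k * real h))
       \<le> C * omega \<alpha> h"
    using dyadic_sum_le_omega[OF assms] by blast
  have "(\<Sum>S \<in> Pow {1..n} - {{}}. real (card S) powr \<alpha> * (fourier_coeff n (indicat_real A) S)\<^sup>2)
        \<le> 4 * C * cube_expectation n (\<lambda>x. omega \<alpha> (boundary_count n A x))" for n A
  proof -
    let ?c = "fourier_coeff n (indicat_real A)" and ?h = "boundary_count n A"
    have "real (card S) powr \<alpha> \<le> 4 * (\<Sum>k\<le>n. (2 powr \<alpha>) ^ k * (1 - (1 - (1/2) ^ k) ^ card S))"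
      if "S \<in> Pow {1..n}" for S
    proof (cases "S = {}")
      case False
      have "card S \<le> n" using that card_mono[of "{1..n}" S] by simp
      moreover have "1 \<le> card S"
        using that False finite_subset[of S "{1..n}"] by (simp add: Suc_le_eq card_gt_0_iff)
      ultimately show ?thesis using powr_le_dyadic_sum[OF assms] by blast
    qed simp
    then have "(\<Sum>S \<in> Pow {1..n}. real (card S) powr \<alpha> * (?c S)\<^sup>2)
        \<le> (\<Sum>S \<in> Pow {1..n}. 4 * (\<Sum>k\<le>n. (2 powr \<alpha>) ^ k * (1 - (1 - (1/2) ^ k) ^ card S)) * (?c S)\<^sup>2)"
      by (intro sum_mono mult_right_mono) auto
    also have "\<dots> = 4 * (\<Sum>k\<le>n. (2 powr \<alpha>) ^ k * (\<Sum>S \<in> Pow {1..n}. (1 - (1 - (1/2) ^ k) ^ card S) * (?c S)\<^sup>2))"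
      by (simp add: sum_distrib_left sum_distrib_right mult.assoc sum.swap[of _ "{..n}"])
    also have "\<dots> \<le> 4 * (\<Sum>k\<le>n. (2 powr \<alpha>) ^ k *
         cube_expectation n (\<lambda>x. min (sqrt ((1/2) ^ k * real (?h x))) ((1/2) ^ k * real (?h x))))"
      by (intro mult_left_mono sum_mono noise_sensitivity_le) (auto simp: power_le_one)
    also have "\<dots> = 4 * cube_expectation n (\<lambda>x. \<Sum>k\<le>n. (2 powr \<alpha>) ^ k *
         min (sqrt ((1/2) ^ k * real (?h x))) ((1/2) ^ k * real (?h x)))"
      by (simp only: cube_expectation_sum cube_expectation_cmult)
    also have "\<dots> \<le> 4 * cube_expectation n (\<lambda>x. C * omega \<alpha> (?h x))"
      by (intro mult_left_mono cube_expectation_mono C(2)) auto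
    also have "\<dots> = 4 * C * cube_expectation n (\<lambda>x. omega \<alpha> (?h x))"
      by (simp add: cube_expectation_cmult)
    finally have "(\<Sum>S \<in> Pow {1..n}. real (card S) powr \<alpha> * (?c S)\<^sup>2)
        \<le> 4 * C * cube_expectation n (\<lambda>x. omega \<alpha> (?h x))" .
    moreover have "(\<Sum>S \<in> Pow {1..n} - {{}}. real (card S) powr \<alpha> * (?c S)\<^sup>2)
        \<le> (\<Sum>S \<in> Pow {1..n}. real (card S) powr \<alpha> * (?c S)\<^sup>2)"
      by (intro sum_mono2) auto
    ultimately show ?thesis by linarith
  qed
  then show ?thesis by blast
qed

theorem theorem6p5:
  shows "(\<forall>\<alpha>::real. 0 < \<alpha> \<and> \<alpha> < 1 \<longrightarrow>
            (\<exists>C::real. \<forall>n::nat. n \<ge> 1 \<longrightarrow> (\<forall>A. A \<subseteq> cube n \<longrightarrow>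
              (\<Sum>S \<in> Pow {1..n} - {{}}.
                  real (card S) powr \<alpha> * (fourier_coeff n (indicat_real A) S)\<^sup>2)
                \<le> C * cube_expectation n (\<lambda>x. omega \<alpha> (boundary_count n A x)))))
       \<and> (\<exists>C::real. \<forall>n::nat. n \<ge> 1 \<longrightarrow> (\<forall>A. A \<subseteq> cube n \<longrightarrow>
              (\<Sum>S \<in> Pow {1..n} - {{}}.
                  sqrt (real (card S)) * (fourier_coeff n (indicat_real A) S)\<^sup>2)
                \<le> C * cube_expectation n (\<lambda>x. sqrt (real (boundary_count n A x))
                                              * ln (exp 1 + real (boundary_count n A x)))))"
proof (intro conjI allI impI)
  fix \<alpha> :: real assume "0 < \<alpha> \<and> \<alpha> < 1"
  then show "\<exists>C::real. \<forall>n::nat. n \<ge> 1 \<longrightarrow> (\<forall>A. A \<subseteq> cube n \<longrightarrow>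
              (\<Sum>S \<in> Pow {1..n} - {{}}.
                  real (card S) powr \<alpha> * (fourier_coeff n (indicat_real A) S)\<^sup>2)
                \<le> C * cube_expectation n (\<lambda>x. omega \<alpha> (boundary_count n A x)))"
    using fractional_fourier_weight_le[of \<alpha>] by blast
next
  have om: "omega (1/2) m = sqrt (real m) * ln (exp 1 + real m)" for m
    by (simp add: omega_def)
  have pw: "real m powr (1/2) = sqrt (real m)" for m
    by (simp add: powr_half_sqrt)
  show "\<exists>C::real. \<forall>n::nat. n \<ge> 1 \<longrightarrow> (\<forall>A. A \<subseteq> cube n \<longrightarrow>
              (\<Sum>S \<in> Pow {1..n} - {{}}.
                  sqrt (real (card S)) * (fourier_coeff n (indicat_real A) S)\<^sup>2)
                \<le> C * cube_expectation n (\<lambda>x. sqrt (real (boundary_count n A x))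
                                              * ln (exp 1 + real (boundary_count n A x))))"
    using fractional_fourier_weight_le[of "1/2"] unfolding om pw by auto
qed

end
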